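(* Consider two vehicles, ownship ($o$) and intruder ($i$), each performing non-deterministic turn-to-bearing motion, and let $C=E^o\cap E^i$. Let $p\in C$ with $W(p)$, where $W(p)=\big(t^o_e(p)\le t^i_e(p)\le t^o_l(p)\big)\lor\big(t^i_e(p)\le t^o_e(p)\le t^i_l(p)\big)$. Then a collision at $p$ may only occur in the time interval $\big[\max(t^i_e(p),t^o_e(p)),\ \min(t^i_l(p),t^o_l(p))\big]$: for any ownship trajectory $J^o$, intruder trajectory $J^i$ and time $t$ with $J^o(t)=J^i(t)=p$, we have $\max(t^i_e(p),t^o_e(p))\le t\le\min(t^i_l(p),t^o_l(p))$.
   Context: Non-deterministic turn-to-bearing motion of a vehicle is described by a tuple $(x_0,y_0,\theta_0,r_\alpha,r_\beta,\theta_\alpha,\theta_\beta,s_\alpha,s_\beta)$ with either $0<r_\alpha\le r_\beta$, $0<\theta_\alpha<\theta_\beta<2\pi$ (left turn) or $r_\alpha\le r_\beta<0$, $-2\pi<\theta_\alpha<\theta_\beta<0$ (right turn), and $0<s_\alpha\le s_\beta$. A trajectory is determined by $r\in[r_\alpha,r_\beta]$, $\theta_c\in[\theta_\alpha,\theta_\beta]$ and a continuous speed function $s$ with $s(u)\in[s_\alpha,s_\beta]$ for all $u$; with $d(t)=\int_0^t s(\gamma)\,d\gamma$, it is $J(t)=(J_x(t),J_y(t))$ where for $d(t)\le r\theta_c$: $J_x=r\sin(d(t)/r+\theta_0)-r\sin\theta_0+x_0$, $J_y=-r\cos(d(t)/r+\theta_0)+r\cos\theta_0+y_0$; and for $d(t)>r\theta_c$: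 $J_x=(d(t)-r\theta_c)\cos(\theta_c+\theta_0)+r\sin(\theta_c+\theta_0)-r\sin\theta_0+x_0$, $J_y=(d(t)-r\theta_c)\sin(\theta_c+\theta_0)-r\cos(\theta_c+\theta_0)+r\cos\theta_0+y_0$. The reachable envelope is $E=\{p:\exists$ trajectory $J$ and $u>0$ with $J(u)=p\}$. For $p\in E$, $\mathcal T(p)$ is the set of trajectories $J$ with $J(u)=p$ for some $u>0$, $I(p)=\{t_a: J\in\mathcal T(p),\ J(t_a)=p\}$, $t_e(p)=\inf I(p)$, $t_l(p)=\sup I(p)$. Ownship and intruder each have their own tuple; superscripts $o,i$ indicate the vehicle. *)

theory Defs
  imports "HOL-Analysis.Analysis"
begin

record turn_to_bearing =
  init_x :: real
  init_y :: real
  init_heading :: real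
  radius_lo :: real
  radius_hi :: real
  turn_lo :: real
  turn_hi :: real
  speed_lo :: real
  speed_hi :: real

text \<open>The first alternative describes a left turn, the second a right turn.\<close>

definition valid_motion :: "turn_to_bearing \<Rightarrow> bool" where
  "valid_motion V \<longleftrightarrow>
     ((0 < radius_lo V \<and> radius_lo V \<le> radius_hi V \<and>
       0 < turn_lo V \<and> turn_lo V < turn_hi V \<and> turn_hi V < 2 * pi) \<or>
      (radius_lo V \<le> radius_hi V \<and> radius_hi V < 0 \<and>
       - 2 * pi < turn_lo V \<and> turn_lo V < turn_hi V \<and> turn_hi V < 0)) \<and>
     0 < speed_lo V \<and> speed_lo V \<le> speed_hi V"

text \<open>Time ranges over the nonnegative reals; speed functions and paths are total
  functions on \<^typ>\<open>real\<close> of which only the values at nonnegative times matter.\<close>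

definition speed_profile :: "turn_to_bearing \<Rightarrow> (real \<Rightarrow> real) \<Rightarrow> bool" where
  "speed_profile V s \<longleftrightarrow>
     continuous_on {0..} s \<and> (\<forall>u\<ge>0. s u \<in> {speed_lo V..speed_hi V})"

definition dist_travelled :: "(real \<Rightarrow> real) \<Rightarrow> real \<Rightarrow> real" where
  "dist_travelled s t = integral {0..t} s"

definition path_of ::
  "turn_to_bearing \<Rightarrow> real \<Rightarrow> real \<Rightarrow> (real \<Rightarrow> real) \<Rightarrow> real \<Rightarrow> real \<times> real" where
  "path_of V r \<theta>c s t =
     (let d = dist_travelled s t; \<theta>0 = init_heading V; x0 = init_x V; y0 = init_y V in
      if d \<le> r * \<theta>c then
        (r * sin (d / r + \<theta>0) - r * sin \<theta>0 + x0,
         - r * cos (d / r + \<theta>0) + r * cos \<theta>0 + y0)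
      else
        ((d - r * \<theta>c) * cos (\<theta>c + \<theta>0) + r * sin (\<theta>c + \<theta>0) - r * sin \<theta>0 + x0,
         (d - r * \<theta>c) * sin (\<theta>c + \<theta>0) - r * cos (\<theta>c + \<theta>0) + r * cos \<theta>0 + y0))"

definition trajectories :: "turn_to_bearing \<Rightarrow> (real \<Rightarrow> real \<times> real) set" where
  "trajectories V =
     {path_of V r \<theta>c s | r \<theta>c s.
        r \<in> {radius_lo V..radius_hi V} \<and> \<theta>c \<in> {turn_lo V..turn_hi V} \<and> speed_profile V s}"

definition envelope :: "turn_to_bearing \<Rightarrow> (real \<times> real) set" where
  "envelope V = {p. \<exists>J\<in>trajectories V. \<exists>u>0. J u = p}"

definition trajectories_through ::
  "turn_to_bearing \<Rightarrow> real \<times> real \<Rightarrow> (real \<Rightarrow> real \<times> real) set" where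
  "trajectories_through V p = {J \<in> trajectories V. \<exists>u>0. J u = p}"

definition arrival_times :: "turn_to_bearing \<Rightarrow> real \<times> real \<Rightarrow> real set" where
  "arrival_times V p = {t. 0 \<le> t \<and> (\<exists>J\<in>trajectories_through V p. J t = p)}"

text \<open>The infimum and supremum are taken in \<^typ>\<open>real\<close>.  For a valid motion and a point of
  the envelope the set of arrival times is nonempty and bounded: speeds are bounded away
  from 0, and the path is unbounded once the turn, of bounded length, is completed.\<close>

definition earliest_arrival :: "turn_to_bearing \<Rightarrow> real \<times> real \<Rightarrow> real" where
  "earliest_arrival V p = Inf (arrival_times V p)"

definition latest_arrival :: "turn_to_bearing \<Rightarrow> real \<times> real \<Rightarrow> real" where
  "latest_arrival V p = Sup (arrival_times V p)"

definition arrival_overlap ::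
  "turn_to_bearing \<Rightarrow> turn_to_bearing \<Rightarrow> real \<times> real \<Rightarrow> bool" where
  "arrival_overlap Vo Vi p \<longleftrightarrow>
     (earliest_arrival Vo p \<le> earliest_arrival Vi p \<and>
      earliest_arrival Vi p \<le> latest_arrival Vo p) \<or>
     (earliest_arrival Vi p \<le> earliest_arrival Vo p \<and>
      earliest_arrival Vo p \<le> latest_arrival Vi p)"

end

theory Submission
  imports Defs
begin

text \<open>By definition of infimum and supremum it suffices that \<^term>\<open>t\<close> is an arrival time of
  either vehicle at \<^term>\<open>p\<close>, and that arrival times are bounded above.  Boundedness: on the
  straight leg the displacement along the final heading grows with the distance travelled,
  which in turn is at least the minimal speed times the time.  Arrival times are realised by
  trajectories through \<^term>\<open>p\<close> at a positive time, so \<^term>\<open>t = 0\<close> has to be excluded: the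
  starting point is never revisited, since the turn is less than a full circle and the
  straight leg stays strictly outside that circle.\<close>

text \<open>Used in both directions between distance and time: a positive time forces a positive
  distance, and a bound on distance bounds the time.\<close>

lemma dist_travelled_ge:
  assumes "speed_profile V s" and "0 \<le> t"
  shows "speed_lo V * t \<le> dist_travelled s t"
proof -
  have "s integrable_on {0..t}"
    using assms by (auto simp: speed_profile_def
        intro!: integrable_continuous_interval intro: continuous_on_subset)
  then have "integral {0..t} (\<lambda>_. speed_lo V) \<le> integral {0..t} s"
    using assms by (intro integral_le) (auto simp: speed_profile_def)
  then show ?thesis
    using assms by (simp add: dist_travelled_def mult.commute)
qed

lemma path_of_0:
  assumes "0 < r * \<theta>c"
  shows "path_of V r \<theta>c s 0 = (init_x V, init_y V)"
  using assms by (simp add: path_of_def dist_travelled_def Let_def)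

text \<open>Radius and turn angle share their sign in left and right turns alike, so later arguments
  need no case split on the direction.\<close>

lemma valid_motion_parameters:
  assumes "valid_motion V"
    and "r \<in> {radius_lo V..radius_hi V}" and "\<theta>c \<in> {turn_lo V..turn_hi V}"
  shows "0 < r * \<theta>c" and "\<bar>\<theta>c\<bar> < 2 * pi"
    and "\<bar>r\<bar> \<le> \<bar>radius_lo V\<bar> + \<bar>radius_hi V\<bar>" and "0 < speed_lo V"
  using assms by (auto simp: valid_motion_def intro: mult_pos_pos mult_neg_neg)

text \<open>The subtraction formula gives \<open>cos u = 1\<close>, so \<open>u\<close> is a
  multiple of \<open>2 * pi\<close>, and 0 is the only one in range.\<close>

lemma arc_not_closed:
  fixes u b :: real
  assumes "sin (u + b) = sin b" and "cos (u + b) = cos b" and "\<bar>u\<bar> < 2 * pi"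
  shows "u = 0"
proof -
  have "cos u = cos ((u + b) - b)"
    by simp
  also have "\<dots> = cos b * cos b + sin b * sin b"
    by (simp only: cos_diff assms)
  also have "\<dots> = 1"
    by (metis power2_eq_square sin_cos_squared_add2)
  finally obtain k :: int where k: "u = of_int k * 2 * pi"
    by (auto simp: cos_one_2pi_int)
  then have "\<bar>real_of_int k\<bar> * (2 * pi) < 1 * (2 * pi)"
    using assms(3) by (simp add: abs_mult)
  then have "\<bar>real_of_int k\<bar> < 1"
    by (subst (asm) mult_less_cancel_right_pos) simp_all
  then show ?thesis
    using k by simp
qed

lemma path_of_eq_start_imp:
  assumes "0 < r * \<theta>c" and "\<bar>\<theta>c\<bar> < 2 * pi" and "0 \<le> dist_travelled s t"
    and start: "path_of V r \<theta>c s t = (init_x V, init_y V)"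
  shows "dist_travelled s t = 0"
proof (cases "dist_travelled s t \<le> r * \<theta>c")
  case True
  let ?u = "dist_travelled s t / r"
  have r: "r \<noteq> 0"
    using assms(1) by auto
  have "sin (?u + init_heading V) = sin (init_heading V)"
    and "cos (?u + init_heading V) = cos (init_heading V)"
    using start True r by (auto simp: path_of_def Let_def)
  \<comment> \<open>On the arc, \<open>?u\<close> is the signed angle turned so far, which cannot
    exceed the full turn.\<close>
  moreover have "\<bar>?u\<bar> \<le> \<bar>\<theta>c\<bar>"
  proof -
    have "\<bar>dist_travelled s t\<bar> \<le> \<bar>r\<bar> * \<bar>\<theta>c\<bar>"
      using True assms(1,3) by (simp flip: abs_mult)
    then show ?thesis
      using r by (simp add: abs_divide divide_le_eq mult.commute)
  qed
  ultimately have "?u = 0"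
    using assms(2) by (intro arc_not_closed) auto
  then show ?thesis
    using r by simp
next
  case False
  define l where "l = dist_travelled s t - r * \<theta>c"
  let ?a = "\<theta>c + init_heading V" and ?b = "init_heading V"
  \<comment> \<open>Both sides are coordinates relative to the centre of the turning circle: the
    current position on the left, the start on the right.\<close>
  have x: "l * cos ?a + r * sin ?a = r * sin ?b"
    and y: "l * sin ?a - r * cos ?a = - (r * cos ?b)"
    using start False by (auto simp: path_of_def Let_def l_def)
  text \<open>Squared distance from the centre of the turning circle.\<close>
  have "l\<^sup>2 + r\<^sup>2 = (l\<^sup>2 + r\<^sup>2) * ((sin ?a)\<^sup>2 + (cos ?a)\<^sup>2)"
    by simp
  also have "\<dots> = (l * cos ?a + r * sin ?a)\<^sup>2 + (l * sin ?a - r * cos ?a)\<^sup>2"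
    by algebra
  also have "\<dots> = r\<^sup>2 * ((sin ?b)\<^sup>2 + (cos ?b)\<^sup>2)"
    unfolding x y by algebra
  finally have "l = 0"
    by simp
  then show ?thesis
    using False by (simp add: l_def)
qed

lemma start_notin_envelope:
  assumes "valid_motion V"
  shows "(init_x V, init_y V) \<notin> envelope V"
proof
  assume "(init_x V, init_y V) \<in> envelope V"
  then obtain r \<theta>c s u where r: "r \<in> {radius_lo V..radius_hi V}"
    and \<theta>c: "\<theta>c \<in> {turn_lo V..turn_hi V}" and s: "speed_profile V s"
    and u: "0 < u" "path_of V r \<theta>c s u = (init_x V, init_y V)"
    by (auto simp: envelope_def trajectories_def)
  note par = valid_motion_parameters[OF assms r \<theta>c]
  have "0 < speed_lo V * u"
    using par(4) u(1) by simp
  also have "\<dots> \<le> dist_travelled s u"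
    using dist_travelled_ge[OF s] u(1) by simp
  finally show False
    using path_of_eq_start_imp[OF par(1,2) _ u(2)] by simp
qed

lemma dist_travelled_le:
  assumes "\<bar>\<theta>c\<bar> < 2 * pi" and p: "path_of V r \<theta>c s t = (x, y)"
  shows "dist_travelled s t \<le>
    \<bar>r\<bar> * (2 * pi) + \<bar>r\<bar> + \<bar>x - init_x V\<bar> + \<bar>y - init_y V\<bar>"
proof -
  have arc: "r * \<theta>c \<le> \<bar>r\<bar> * (2 * pi)"
  proof -
    have "r * \<theta>c \<le> \<bar>r\<bar> * \<bar>\<theta>c\<bar>"
      by (metis abs_ge_self abs_mult)
    also have "\<dots> \<le> \<bar>r\<bar> * (2 * pi)"
      using assms(1) by (intro mult_left_mono) auto
    finally show ?thesis .
  qed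
  show ?thesis
  proof (cases "dist_travelled s t \<le> r * \<theta>c")
    case True
    then show ?thesis
      using arc by simp
  next
    case False
    define l where "l = dist_travelled s t - r * \<theta>c"
    define a where "a = \<theta>c + init_heading V"
    let ?b = "init_heading V" and ?X = "x - init_x V" and ?Y = "y - init_y V"
    have X: "?X = l * cos a + r * sin a - r * sin ?b"
      and Y: "?Y = l * sin a - r * cos a + r * cos ?b"
      using p False by (auto simp: path_of_def Let_def l_def a_def)
    \<comment> \<open>Projecting the displacement onto the final heading isolates \<open>l\<close>;
      the arc contributes only \<open>r * sin \<theta>c\<close>.\<close>
    have "?X * cos a + ?Y * sin a =
        l * ((sin a)\<^sup>2 + (cos a)\<^sup>2) + r * (sin a * cos ?b - cos a * sin ?b)"
      unfolding X Y by algebra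
    also have "\<dots> = l + r * sin \<theta>c"
      by (simp add: a_def flip: sin_diff)
    finally have "l = ?X * cos a + ?Y * sin a - r * sin \<theta>c"
      by simp
    moreover have "?X * cos a \<le> \<bar>?X\<bar>" "?Y * sin a \<le> \<bar>?Y\<bar>" "- (r * sin \<theta>c) \<le> \<bar>r\<bar>"
      by (rule order_trans[OF abs_ge_self] order_trans[OF abs_ge_minus_self],
          simp add: abs_mult mult_left_le)+
    ultimately show ?thesis
      using arc by (simp add: l_def)
  qed
qed

lemma bdd_above_arrival_times:
  assumes "valid_motion V"
  shows "bdd_above (arrival_times V p)"
proof (rule bdd_aboveI)
  fix t
  obtain x y where p: "p = (x, y)"
    by fastforce
  define R where "R = \<bar>radius_lo V\<bar> + \<bar>radius_hi V\<bar>"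
  assume "t \<in> arrival_times V p"
  then obtain r \<theta>c s where r: "r \<in> {radius_lo V..radius_hi V}"
    and \<theta>c: "\<theta>c \<in> {turn_lo V..turn_hi V}" and s: "speed_profile V s"
    and t: "0 \<le> t" "path_of V r \<theta>c s t = (x, y)"
    by (auto simp: p arrival_times_def trajectories_through_def trajectories_def)
  note par = valid_motion_parameters[OF assms r \<theta>c]
  have "speed_lo V * t \<le> dist_travelled s t"
    using dist_travelled_ge[OF s t(1)] .
  also have "\<dots> \<le> \<bar>r\<bar> * (2 * pi) + \<bar>r\<bar> + \<bar>x - init_x V\<bar> + \<bar>y - init_y V\<bar>"
    using dist_travelled_le[OF par(2) t(2)] .
  \<comment> \<open>Replacing the radius of the trajectory by \<open>R\<close> makes the bound
    uniform over all trajectories.\<close>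
  also have "\<dots> \<le> R * (2 * pi) + R + \<bar>x - init_x V\<bar> + \<bar>y - init_y V\<bar>"
    using par(3) by (intro add_mono mult_right_mono) (auto simp: R_def)
  finally show "t \<le> (R * (2 * pi) + R + \<bar>fst p - init_x V\<bar> + \<bar>snd p - init_y V\<bar>) / speed_lo V"
    using par(4) by (simp add: p le_divide_eq mult.commute)
qed

text \<open>Membership asks for a visit to \<open>p\<close> at a positive time. The given
  \<open>t\<close> is such a time unless it is 0, and then \<open>p\<close> would be the starting
  point, which lies outside the envelope.\<close>

lemma mem_arrival_times:
  assumes "valid_motion V" and "p \<in> envelope V" and J: "J \<in> trajectories V" "J t = p"
    and "0 \<le> t"
  shows "t \<in> arrival_times V p"
proof -
  have "t \<noteq> 0"
  proof
    assume "t = 0"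
    from J(1) obtain r \<theta>c s where "J = path_of V r \<theta>c s"
      and "r \<in> {radius_lo V..radius_hi V}" and "\<theta>c \<in> {turn_lo V..turn_hi V}"
      by (auto simp: trajectories_def)
    then have "p = (init_x V, init_y V)"
      using J(2) \<open>t = 0\<close> path_of_0 valid_motion_parameters(1)[OF assms(1)] by metis
    then show False
      using start_notin_envelope assms(1,2) by blast
  qed
  then show ?thesis
    using assms by (auto simp: arrival_times_def trajectories_through_def less_le)
qed

lemma arrival_time_bounds:
  assumes "valid_motion V" and "t \<in> arrival_times V p"
  shows "earliest_arrival V p \<le> t" and "t \<le> latest_arrival V p"
proof -
  \<comment> \<open>\<open>Inf\<close> and \<open>Sup\<close> on the reals bound a set only if it is
    bounded; below, this holds because times are nonnegative.\<close>
  have "bdd_below (arrival_times V p)"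
    by (rule bdd_belowI[of _ 0]) (simp add: arrival_times_def)
  then show "earliest_arrival V p \<le> t"
    unfolding earliest_arrival_def using assms(2) by (rule cInf_lower[rotated])
  show "t \<le> latest_arrival V p"
    unfolding latest_arrival_def
    using assms(2) bdd_above_arrival_times[OF assms(1)] by (rule cSup_upper)
qed

theorem theorem6:
  fixes Vo Vi :: turn_to_bearing
    and p :: "real \<times> real"
    and Jo Ji :: "real \<Rightarrow> real \<times> real"
    and t :: real
  assumes "valid_motion Vo" and "valid_motion Vi"
    and "p \<in> envelope Vo \<inter> envelope Vi"
    and "arrival_overlap Vo Vi p"
    and "Jo \<in> trajectories Vo" and "Ji \<in> trajectories Vi"
    and "0 \<le> t" and "Jo t = p" and "Ji t = p"
  shows "max (earliest_arrival Vi p) (earliest_arrival Vo p) \<le> t \<and>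
         t \<le> min (latest_arrival Vi p) (latest_arrival Vo p)"
proof -
  have "t \<in> arrival_times Vo p" and "t \<in> arrival_times Vi p"
    using assms by (auto intro: mem_arrival_times)
  then show ?thesis
    using assms(1,2) by (simp add: arrival_time_bounds)
qed

end
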